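(* Let $(X,\|\cdot\|)$ be a real normed space, let $n\ge2$, let $v_1,\ldots,v_n\in X$ be distinct vectors, and let $p,q\in(1,\infty)$ with $\frac1p+\frac1q=1$. Let $\mathrm{Sol}$ be the set of all global minimizers over $u\in X$ of $f(u):=\big(\sum_{i=1}^n\|u-v_i\|^p\big)^{1/p}$. Then a vector $\bar u\in X$ belongs to $\mathrm{Sol}$ if and only if there exist $x_1^*,\ldots,x_n^*\in X^*$ such that $$\sum_{i=1}^n x_i^*=0,\qquad \sum_{i=1}^n(\|x_i^*\|^* )^q=1,$$ $$\langle x_i^*,\bar u-v_i\rangle=\|x_i^*\|^*\cdot\|\bar u-v_i\|,\qquad (\|x_i^*\|^* )^q=\frac{\|\bar u-v_i\|^p}{\sum_{j=1}^n\|\bar u-v_j\|^p}\qquad(i=1,\ldots,n).$$ Moreover, if $\bar u\in\mathrm{Sol}$ and $x_1^*,\ldots,x_n^*$ satisfy these conditions, then $\mathrm{Sol}=\bigcap_{i=1}^n \mathbf{C}_i$, where $$\mathbf{C}_i:=\Big\{u\in X\;\Big|\;\langle x_i^*,u-v_i\rangle=\|x_i^*\|^*\cdot\|u-v_i\|\ \text{ and }\ (\|x_i^*\|^* )^q=\frac{\|u-v_i\|^p}{\sum_{j=1}^n\|u-v_j\|^p}\Big\}.$$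
   Context: $X^*$ is the topological dual of $X$, $\|\cdot\|^*$ the dual norm on $X^*$, and $\langle\cdot,\cdot\rangle$ the duality pairing. *)

theory Defs
  imports "HOL-Analysis.Analysis"
begin

text \<open>
  The dual \<open>X\<^sup>*\<close> is the type \<open>'a \<Rightarrow>\<^sub>L real\<close> of bounded linear functionals, whose \<open>norm\<close> is the
  operator norm; the pairing of \<open>x\<close> and \<open>u\<close> is the application \<open>blinfun_apply x u\<close>.
  Families indexed by \<open>1, \<dots>, n\<close> are functions on \<open>nat\<close>, whose values are only used on \<open>{1..n}\<close>.
  Real powers use \<open>powr\<close>; note that \<open>0 powr p = 0\<close>, as required for \<open>p > 0\<close>.
\<close>

definition pdist :: "nat \<Rightarrow> real \<Rightarrow> (nat \<Rightarrow> 'a::real_normed_vector) \<Rightarrow> 'a \<Rightarrow> real" where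
  "pdist n p v u = (\<Sum>i=1..n. norm (u - v i) powr p) powr (1 / p)"

definition Sol :: "nat \<Rightarrow> real \<Rightarrow> (nat \<Rightarrow> 'a::real_normed_vector) \<Rightarrow> 'a set" where
  "Sol n p v = {u. \<forall>w. pdist n p v u \<le> pdist n p v w}"

definition C_set ::
  "nat \<Rightarrow> real \<Rightarrow> real \<Rightarrow> (nat \<Rightarrow> 'a::real_normed_vector) \<Rightarrow> (nat \<Rightarrow> 'a \<Rightarrow>\<^sub>L real) \<Rightarrow> nat \<Rightarrow> 'a set" where
  "C_set n p q v x i =
     {u. blinfun_apply (x i) (u - v i) = norm (x i) * norm (u - v i) \<and>
         norm (x i) powr q = norm (u - v i) powr p / (\<Sum>j=1..n. norm (u - v j) powr p)}"

definition optimality_conditions ::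
  "nat \<Rightarrow> real \<Rightarrow> real \<Rightarrow> (nat \<Rightarrow> 'a::real_normed_vector) \<Rightarrow> (nat \<Rightarrow> 'a \<Rightarrow>\<^sub>L real) \<Rightarrow> 'a \<Rightarrow> bool" where
  "optimality_conditions n p q v x u \<longleftrightarrow>
     (\<Sum>i=1..n. x i) = 0 \<and>
     (\<Sum>i=1..n. norm (x i) powr q) = 1 \<and>
     (\<forall>i\<in>{1..n}.
        blinfun_apply (x i) (u - v i) = norm (x i) * norm (u - v i) \<and>
        norm (x i) powr q = norm (u - v i) powr p / (\<Sum>j=1..n. norm (u - v j) powr p))"

end

theory Submission
  imports Defs "HOL-Library.Function_Algebras"
begin

text \<open>
  Sufficiency, and the description of the whole solution set, come from duality: since the \<open>x i\<close>
  sum to \<open>0\<close>, the sum of \<open>x i (w - v i)\<close> does not depend on \<open>w\<close>; it equals the objective at \<open>u\<close> and,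
  by Young's inequality, is at most the objective at \<open>w\<close>. At another minimizer equality holds
  termwise. Conversely, convexity shows that a minimizer \<open>u\<close> also minimizes the weighted sum of
  distances \<open>\<Sum>i. c i * norm (w - v i)\<close> with \<open>c i = norm (u - v i) powr (p - 1)\<close>, and the
  Hahn--Banach theorem on the \<open>n\<close>-th power of the space yields functionals of norm \<open>c i\<close> that sum
  to \<open>0\<close> and norm the vectors \<open>u - v i\<close>; the \<open>x i\<close> are a common multiple of these.
\<close>

section \<open>Sublinear functionals\<close>

definition sublinear :: "('a::real_vector \<Rightarrow> real) \<Rightarrow> bool" where
  "sublinear P \<longleftrightarrow> (\<forall>x y. P (x + y) \<le> P x + P y) \<and> (\<forall>c\<ge>0. \<forall>x. P (c *\<^sub>R x) = c * P x)"

text \<open>One-sided homogeneity suffices: using it again with factor \<open>inverse c\<close> at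
  \<open>c *\<^sub>R x\<close> gives the reverse inequality. Infima yield just such one-sided
  bounds.\<close>

lemma sublinearI:
  assumes "\<And>x y. P (x + y) \<le> P x + P y"
    and "\<And>c x. c > 0 \<Longrightarrow> P (c *\<^sub>R x) \<le> c * P x"
    and "P 0 = 0"
  shows "sublinear P"
  unfolding sublinear_def
proof (intro conjI allI impI)
  fix c :: real and x
  assume "c \<ge> 0"
  show "P (c *\<^sub>R x) = c * P x"
  proof (cases "c = 0")
    case False
    with \<open>c \<ge> 0\<close> have c: "c > 0" by simp
    have "P (inverse c *\<^sub>R (c *\<^sub>R x)) \<le> inverse c * P (c *\<^sub>R x)"
      using c by (intro assms(2)) simp
    then have "c * P x \<le> P (c *\<^sub>R x)"
      using c by (simp add: field_simps)
    with assms(2)[OF c, of x] show ?thesis by simp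
  qed (use assms(3) in simp)
qed (rule assms(1))

lemma sublinear_add: "sublinear P \<Longrightarrow> P (x + y) \<le> P x + P y"
  and sublinear_scale: "sublinear P \<Longrightarrow> c \<ge> 0 \<Longrightarrow> P (c *\<^sub>R x) = c * P x"
  by (auto simp: sublinear_def)

lemma sublinear_0: "sublinear P \<Longrightarrow> P 0 = 0"
  using sublinear_scale[of P 0 0] by simp

lemma sublinear_minus: "sublinear P \<Longrightarrow> - P (- x) \<le> P x"
  using sublinear_add[of P x "- x"] sublinear_0[of P] by simp

text \<open>Subadditivity at \<open>- x\<close> and \<open>- y\<close> turns, by oddness, into
  superadditivity at \<open>x\<close> and \<open>y\<close>; oddness also carries homogeneity over to
  negative scalars.\<close>

lemma sublinear_odd_imp_linear:
  assumes P: "sublinear P" and odd: "\<And>x. P (- x) \<le> - P x"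
  shows "linear P"
proof (rule linearI)
  have neg: "P (- x) = - P x" for x
    using odd[of x] sublinear_minus[OF P, of x] by simp
  show "P (x + y) = P x + P y" for x y
    using sublinear_add[OF P, of x y] sublinear_add[OF P, of "- x" "- y"] neg[of x] neg[of y]
      neg[of "x + y"] by simp
  show "P (c *\<^sub>R x) = c *\<^sub>R P x" for c x
  proof (cases "c \<ge> 0")
    case False
    then show ?thesis
      using sublinear_scale[OF P, of "- c" x] neg[of "c *\<^sub>R x"] by simp
  qed (use sublinear_scale[OF P] in simp)
qed

text \<open>Zorn's lemma: the pointwise infimum of a nonempty chain is again sublinear, and it is
  finite because every member is bounded below at \<open>x\<close> by
  \<open>- N (- x)\<close>.\<close>

lemma sublinear_minimal:
  fixes N :: "'a::real_vector \<Rightarrow> real"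
  assumes N: "sublinear N"
  obtains P where "sublinear P" "P \<le> N" "\<And>Q. sublinear Q \<Longrightarrow> Q \<le> P \<Longrightarrow> Q = P"
proof -
  define A where "A = {P. sublinear P \<and> P \<le> N}"
  have "\<exists>P\<in>A. \<forall>Q\<in>A. P \<ge> Q \<longrightarrow> Q = P"
  proof (rule predicate_Zorn)
    show "partial_order_on A (relation_of (\<ge>) A)"
      by (rule partial_order_on_relation_ofI) auto
    fix C assume C: "C \<in> Chains (relation_of (\<ge>) A)"
    then have CA: "C \<subseteq> A"
      by (auto simp: Chains_def relation_of_def)
    have total: "P \<le> Q \<or> Q \<le> P" if "P \<in> C" "Q \<in> C" for P Q
      using that C by (auto simp: Chains_def relation_of_def)
    show "\<exists>U\<in>A. \<forall>P\<in>C. P \<ge> U"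
    proof (cases "C = {}")
      case True
      have "N \<in> A" using N by (simp add: A_def)
      then show ?thesis using True by auto
    next
      case False
      have bdd: "bdd_below ((\<lambda>P. P x) ` C)" for x
      proof (rule bdd_belowI2)
        fix P assume "P \<in> C"
        then have "sublinear P" "P (- x) \<le> N (- x)"
          using CA by (auto simp: A_def le_fun_def)
        then show "- N (- x) \<le> P x" using sublinear_minus[of P x] by simp
      qed
      define U where "U x = (INF P\<in>C. P x)" for x
      have UP: "U x \<le> P x" if "P \<in> C" for P x
        unfolding U_def by (rule cINF_lower[OF bdd that])
      have U_greatest: "m \<le> U x" if "\<And>P. P \<in> C \<Longrightarrow> m \<le> P x" for m x
        unfolding U_def using False that by (rule cINF_greatest)
      have sub: "sublinear P" if "P \<in> C" for P using CA that by (auto simp: A_def)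
      have "sublinear U"
      proof (rule sublinearI)
        fix x y
        have "U (x + y) \<le> P x + Q y" if PQ: "P \<in> C" "Q \<in> C" for P Q
        proof -
          \<comment> \<open>The smaller of \<open>P\<close> and \<open>Q\<close> serves as
            \<open>R\<close>, which decouples the infima at \<open>x\<close> and at
            \<open>y\<close>.\<close>
          obtain R where R: "R \<in> C" "R \<le> P" "R \<le> Q"
            using total[OF PQ] PQ by auto
          have "U (x + y) \<le> R (x + y)" by (rule UP) fact
          also have "\<dots> \<le> R x + R y" by (rule sublinear_add[OF sub[OF R(1)]])
          also have "\<dots> \<le> P x + Q y" using R by (auto simp: le_fun_def intro: add_mono)
          finally show ?thesis .
        qed
        then have "U (x + y) - Q y \<le> U x" if "Q \<in> C" for Q
          using that by (intro U_greatest) (simp add: algebra_simps)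
        then have "U (x + y) - U x \<le> U y"
          by (intro U_greatest) (simp add: algebra_simps)
        then show "U (x + y) \<le> U x + U y" by simp
      next
        fix c :: real and x assume c: "c > 0"
        have "U (c *\<^sub>R x) / c \<le> U x"
          using UP[of _ "c *\<^sub>R x"] sub c
          by (intro U_greatest) (force simp: sublinear_scale field_simps)
        then show "U (c *\<^sub>R x) \<le> c * U x" using c by (simp add: field_simps)
      next
        show "U 0 = 0"
          using False sub by (auto simp: U_def sublinear_0)
      qed
      moreover have "U \<le> N"
      proof (rule le_funI)
        obtain P where "P \<in> C" using False by auto
        then show "U x \<le> N x" for x
          using CA UP[of P x] by (auto simp: A_def le_fun_def intro: order_trans)
      qed
      ultimately show ?thesis
        using UP by (intro bexI[of _ U]) (auto simp: A_def le_fun_def)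
    qed
  qed
  then show thesis
    using that by (auto simp: A_def dest: order_trans)
qed

text \<open>The witness is an infimal convolution of \<open>N\<close> with the constraints:
  \<open>k = 0\<close> gives \<open>P \<le> N\<close>, and evaluating at \<open>- h k\<close> gives
  the last claim. A linear \<open>F\<close> below \<open>P\<close> then satisfies
  \<open>g k \<le> F (h k)\<close>, so the constraints are built into the majorant.\<close>

lemma sublinear_envelope:
  fixes N :: "'a::real_vector \<Rightarrow> real" and h :: "'b::real_vector \<Rightarrow> 'a" and g :: "'b \<Rightarrow> real"
  assumes N: "sublinear N" and h: "linear h" and g: "linear g"
    and K: "convex_cone K" and le: "\<And>k. k \<in> K \<Longrightarrow> g k \<le> N (h k)"
  obtains P where "sublinear P" "P \<le> N" "\<And>k. k \<in> K \<Longrightarrow> P (- h k) \<le> - g k"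
proof -
  have K0: "0 \<in> K" and K_add: "x \<in> K \<Longrightarrow> y \<in> K \<Longrightarrow> x + y \<in> K"
    and K_scale: "x \<in> K \<Longrightarrow> c \<ge> 0 \<Longrightarrow> c *\<^sub>R x \<in> K" for x y c
    using K by (auto simp: convex_cone_iff)
  define P where "P z = (INF k\<in>K. N (z + h k) - g k)" for z
  \<comment> \<open>This makes the infimum finite:
    \<open>g k \<le> N (h k) \<le> N (- z) + N (z + h k)\<close>.\<close>
  have lower: "- N (- z) \<le> N (z + h k) - g k" if "k \<in> K" for z k
    using le[OF that] sublinear_add[OF N, of "- z" "z + h k"] by simp
  then have bdd: "bdd_below ((\<lambda>k. N (z + h k) - g k) ` K)" for z
    by (meson bdd_belowI2)
  have PN: "P z \<le> N (z + h k) - g k" if "k \<in> K" for z k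
    unfolding P_def by (rule cINF_lower[OF bdd that])
  have P_greatest: "m \<le> P z" if "\<And>k. k \<in> K \<Longrightarrow> m \<le> N (z + h k) - g k" for m z
    unfolding P_def using K0 that by (intro cINF_greatest) auto
  have "sublinear P"
  proof (rule sublinearI)
    fix x y
    have "P (x + y) \<le> (N (x + h k) - g k) + (N (y + h l) - g l)" if "k \<in> K" "l \<in> K" for k l
      using PN[OF K_add[OF that], of "x + y"] sublinear_add[OF N, of "x + h k" "y + h l"]
      by (simp add: linear_add[OF h] linear_add[OF g] algebra_simps)
    then have "P (x + y) - (N (y + h l) - g l) \<le> P x" if "l \<in> K" for l
      using that by (intro P_greatest) (simp add: algebra_simps)
    then have "P (x + y) - P x \<le> P y"
      by (intro P_greatest) (simp add: algebra_simps)
    then show "P (x + y) \<le> P x + P y" by simp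
  next
    fix c :: real and x assume c: "c > 0"
    have "P (c *\<^sub>R x) / c \<le> P x"
    proof (rule P_greatest)
      \<comment> \<open>The competitor \<open>k\<close> at \<open>x\<close> corresponds to the
        competitor \<open>c *\<^sub>R k\<close> at \<open>c *\<^sub>R x\<close>.\<close>
      fix k assume "k \<in> K"
      then have "P (c *\<^sub>R x) \<le> N (c *\<^sub>R x + h (c *\<^sub>R k)) - g (c *\<^sub>R k)"
        using c by (intro PN K_scale) auto
      also have "\<dots> = N (c *\<^sub>R (x + h k)) - c * g k"
        by (simp add: linear_scale[OF h] linear_scale[OF g] scaleR_add_right)
      also have "\<dots> = c * (N (x + h k) - g k)"
        using c by (simp only: sublinear_scale[OF N less_imp_le[OF c]]) (simp add: algebra_simps)
      finally show "P (c *\<^sub>R x) / c \<le> N (x + h k) - g k"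
        using c by (simp add: field_simps)
    qed
    then show "P (c *\<^sub>R x) \<le> c * P x" using c by (simp add: field_simps)
  next
    have "P 0 \<le> 0" using PN[OF K0, of 0] by (simp add: linear_0[OF h] linear_0[OF g] sublinear_0[OF N])
    moreover have "0 \<le> P 0" using le by (intro P_greatest) simp
    ultimately show "P 0 = 0" by simp
  qed
  moreover have "P \<le> N"
    using PN[OF K0] by (simp add: le_fun_def linear_0[OF h] linear_0[OF g])
  moreover have "P (- h k) \<le> - g k" if "k \<in> K" for k
    using PN[OF that, of "- h k"] by (simp add: sublinear_0[OF N])
  ultimately show thesis by (rule that)
qed

text \<open>
  A minimal sublinear \<open>F\<close> is odd, hence linear: its envelope along the ray through \<open>y\<close> is again \<open>F\<close>.
\<close>

theorem Mazur_Orlicz: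
  fixes N :: "'a::real_vector \<Rightarrow> real" and h :: "'b::real_vector \<Rightarrow> 'a" and g :: "'b \<Rightarrow> real"
  assumes "sublinear N" "linear h" "linear g" "convex_cone K" "\<And>k. k \<in> K \<Longrightarrow> g k \<le> N (h k)"
  obtains F where "linear F" "F \<le> N" "\<And>k. k \<in> K \<Longrightarrow> g k \<le> F (h k)"
proof -
  obtain P where P: "sublinear P" "P \<le> N" "\<And>k. k \<in> K \<Longrightarrow> P (- h k) \<le> - g k"
    using sublinear_envelope[OF assms] by blast
  obtain F where F: "sublinear F" "F \<le> P" and min: "\<And>Q. sublinear Q \<Longrightarrow> Q \<le> F \<Longrightarrow> Q = F"
    using sublinear_minimal[OF P(1)] by blast
  have "F (- y) \<le> - F y" for y
  proof -
    have "linear (\<lambda>t. t *\<^sub>R y)" "linear (\<lambda>t. t * F y)"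
      by (auto intro!: linearI simp: algebra_simps)
    moreover have "convex_cone {0::real..}"
      by (auto simp: convex_cone_iff)
    moreover have "t * F y \<le> F (t *\<^sub>R y)" if "t \<in> {0..}" for t
      using that by (simp add: sublinear_scale[OF F(1)])
    ultimately obtain Q where "sublinear Q" "Q \<le> F"
      "\<And>t. t \<in> {0..} \<Longrightarrow> Q (- (t *\<^sub>R y)) \<le> - (t * F y)"
      using sublinear_envelope[OF F(1), of "\<lambda>t. t *\<^sub>R y" "\<lambda>t. t * F y" "{0..}"] by auto
    then show ?thesis using min[of Q] by (metis atLeast_iff mult_1 scaleR_one zero_le_one)
  qed
  then have lin: "linear F" using F(1) by (intro sublinear_odd_imp_linear)
  moreover have "F \<le> N" using F(2) P(2) by simp
  moreover have "g k \<le> F (h k)" if "k \<in> K" for k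
    using P(3)[OF that] F(2) linear_neg[OF lin, of "h k"] by (simp add: le_fun_def) (smt (verit))
  ultimately show thesis by (rule that)
qed

section \<open>Functionals on powers of a vector space\<close>

instantiation "fun" :: (type, real_vector) real_vector
begin

definition "c *\<^sub>R f = (\<lambda>x. c *\<^sub>R f x)"

instance
  by standard (simp_all add: scaleR_fun_def fun_eq_iff scaleR_add_right scaleR_add_left)

end

lemma sum_fun_apply: "(\<Sum>i\<in>I. f i) x = (\<Sum>i\<in>I. f i x)" for f :: "'i \<Rightarrow> 'b \<Rightarrow> 'c::comm_monoid_add"
  by (induction I rule: infinite_finite_induct) auto

text \<open>
  The functionals are the components of one functional on the power \<open>'i \<Rightarrow> 'a\<close> that is dominated by
  the weighted \<open>\<ell>\<^sup>1\<close> norm, is nonnegative, hence zero, on the diagonal, and attains the norm at \<open>a\<close>.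
\<close>

lemma balanced_norming_functionals:
  fixes a :: "'i \<Rightarrow> 'a::real_normed_vector" and c :: "'i \<Rightarrow> real"
  assumes fin: "finite I" and c: "\<And>i. i \<in> I \<Longrightarrow> c i \<ge> 0"
    and min: "\<And>w. (\<Sum>i\<in>I. c i * norm (a i)) \<le> (\<Sum>i\<in>I. c i * norm (a i + w))"
  obtains f :: "'i \<Rightarrow> 'a \<Rightarrow>\<^sub>L real" where "(\<Sum>i\<in>I. f i) = 0"
    "\<And>i. i \<in> I \<Longrightarrow> norm (f i) \<le> c i" "\<And>i. i \<in> I \<Longrightarrow> blinfun_apply (f i) (a i) = c i * norm (a i)"
proof -
  define N where "N z = (\<Sum>i\<in>I. c i * norm (z i))" for z :: "'i \<Rightarrow> 'a"
  \<comment> \<open>The image of the cone of pairs with \<open>t \<ge> 0\<close> consists of the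
    diagonal plus nonnegative multiples of \<open>a\<close>; \<open>g\<close> asks for at least 0 on
    the diagonal and at least \<open>N a\<close> at \<open>a\<close>. Coordinates off
    \<open>I\<close> vanish, so \<open>h k\<close> is a finite sum of \<open>single\<close>
    vectors.\<close>
  define h where "h = (\<lambda>(w, t) i. if i \<in> I then w + t *\<^sub>R a i else 0)"
  define g where "g = (\<lambda>(w :: 'a, t). t * N a)"
  define single :: "'i \<Rightarrow> 'a \<Rightarrow> 'i \<Rightarrow> 'a" where "single i x = (\<lambda>j. if j = i then x else 0)" for i x
  have N: "sublinear N"
  proof (rule sublinearI)
    show "N (x + y) \<le> N x + N y" for x y
      unfolding N_def sum.distrib[symmetric]
      by (intro sum_mono) (auto simp flip: distrib_left intro!: mult_left_mono norm_triangle_ineq c)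
    show "N (r *\<^sub>R x) \<le> r * N x" if "r > 0" for r x
      using that by (simp add: N_def scaleR_fun_def sum_distrib_left mult_ac)
    show "N 0 = 0" by (simp add: N_def)
  qed
  have h: "linear h"
    by (rule linearI) (auto simp: h_def fun_eq_iff scaleR_fun_def algebra_simps)
  have g: "linear g"
    by (rule linearI) (auto simp: g_def algebra_simps)
  have K: "convex_cone (UNIV \<times> {0..} :: ('a \<times> real) set)"
    by (auto simp: convex_cone_iff zero_prod_def)
  have "g k \<le> N (h k)" if k: "k \<in> UNIV \<times> {0..}" for k
  proof -
    obtain w t where [simp]: "k = (w, t)" by (cases k)
    have t: "t \<ge> 0" using k by auto
    have *: "N (h k) = (\<Sum>i\<in>I. c i * norm (w + t *\<^sub>R a i))"
      by (simp add: N_def h_def)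
    show ?thesis
    proof (cases "t = 0")
      case True
      then show ?thesis unfolding * using c by (auto simp: g_def intro!: sum_nonneg)
    next
      case False
      \<comment> \<open>Factoring out \<open>t\<close> reduces domination to the minimality
        hypothesis at \<open>w /\<^sub>R t\<close>.\<close>
      have "norm (w + t *\<^sub>R a i) = t * norm (a i + w /\<^sub>R t)" for i
      proof -
        have "w + t *\<^sub>R a i = t *\<^sub>R (a i + w /\<^sub>R t)"
          using False by (simp add: scaleR_add_right)
        then show ?thesis using t by simp
      qed
      then have "N (h k) = t * (\<Sum>i\<in>I. c i * norm (a i + w /\<^sub>R t))"
        unfolding * by (simp add: sum_distrib_left mult_ac)
      then show ?thesis using min[of "w /\<^sub>R t"] t by (simp add: g_def N_def mult_left_mono)
    qed
  qed
  then obtain F where F: "linear F" "F \<le> N" and gF: "\<And>k. k \<in> UNIV \<times> {0..} \<Longrightarrow> g k \<le> F (h k)"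
    using Mazur_Orlicz[OF N h g K] by blast
  have single: "linear (single i)" for i
    by (rule linearI) (auto simp: single_def fun_eq_iff scaleR_fun_def)
  have lin: "linear (\<lambda>x. F (single i x))" for i
    using linear_compose[OF single F(1)] by (simp add: o_def)
  have N_single: "N (single i x) = c i * norm x" if "i \<in> I" for i x
  proof -
    have "N (single i x) = (\<Sum>j\<in>I. if j = i then c i * norm x else 0)"
      unfolding N_def single_def by (rule sum.cong) auto
    then show ?thesis using fin that by simp
  qed
  have le: "F (single i x) \<le> c i * norm x" if "i \<in> I" for i x
    using F(2) N_single[OF that] by (simp add: le_fun_def) metis
  have abs: "norm (F (single i x)) \<le> c i * norm x" if "i \<in> I" for i x
    using le[OF that, of x] le[OF that, of "- x"] linear_neg[OF lin, of i x] by simp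
  define f where "f i = Blinfun (\<lambda>x. F (single i x))" for i
  have f: "blinfun_apply (f i) x = F (single i x)" if "i \<in> I" for i x
  proof -
    have "bounded_linear (\<lambda>x. F (single i x))"
      using linear_add[OF lin] linear_scale[OF lin] abs[OF that]
      by (intro bounded_linear_intro[where K = "c i"]) (auto simp: mult.commute)
    then show ?thesis by (simp add: f_def bounded_linear_Blinfun_apply)
  qed
  have sum_f: "(\<Sum>i\<in>I. blinfun_apply (f i) (w + t *\<^sub>R a i)) = F (h (w, t))" for w t
  proof -
    have "h (w, t) = (\<Sum>i\<in>I. single i (w + t *\<^sub>R a i))"
      using fin by (auto simp: h_def fun_eq_iff sum_fun_apply single_def)
    then show ?thesis by (simp add: f linear_sum[OF F(1)])
  qed
  have nonneg: "0 \<le> (\<Sum>i\<in>I. blinfun_apply (f i) w)" for w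
    using gF[of "(w, 0)"] sum_f[of w 0] by (simp add: g_def)
  have sum0: "(\<Sum>i\<in>I. f i) = 0"
  proof (rule blinfun_eqI)
    show "blinfun_apply (\<Sum>i\<in>I. f i) w = blinfun_apply 0 w" for w
      using nonneg[of w] nonneg[of "- w"]
      by (simp add: blinfun.sum_left blinfun.minus_right sum_negf)
  qed
  \<comment> \<open>The constraint at \<open>(0, 1)\<close> bounds the sum from below while each
    term is bounded above, so every term is an equality.\<close>
  have "(\<Sum>i\<in>I. c i * norm (a i)) \<le> (\<Sum>i\<in>I. blinfun_apply (f i) (a i))"
    using gF[of "(0, 1)"] sum_f[of 0 1] by (simp add: g_def N_def)
  moreover have fle: "blinfun_apply (f i) (a i) \<le> c i * norm (a i)" if "i \<in> I" for i
    using f le that by simp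
  ultimately have "(\<Sum>i\<in>I. blinfun_apply (f i) (a i)) = (\<Sum>i\<in>I. c i * norm (a i))"
    by (meson antisym sum_mono)
  then have "blinfun_apply (f i) (a i) = c i * norm (a i)" if "i \<in> I" for i
    by (rule sum_mono_inv) (use fle that fin in auto)
  moreover have "norm (f i) \<le> c i" if "i \<in> I" for i
    using abs f that c by (intro norm_blinfun_bound) auto
  ultimately show thesis using that sum0 by blast
qed

section \<open>Young's inequality\<close>

text \<open>After dividing by \<open>M = a * b\<close>, the weighted sums of \<open>ln t\<close> and
  of \<open>t - 1\<close> at \<open>A / M\<close> and \<open>B / M\<close> both vanish. Since
  \<open>ln t \<le> t - 1\<close> with equality only at 1, both quotients are 1.\<close>

lemma Young_equality_imp:
  fixes a b p q :: real
  assumes "p > 1" "q > 1" "1 / p + 1 / q = 1" "a \<ge> 0" "b \<ge> 0"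
    and eq: "a * b = a powr p / p + b powr q / q"
  shows "a powr p = b powr q"
proof (cases "a = 0 \<or> b = 0")
  case True
  then show ?thesis using assms by auto
next
  case False
  then have pos: "a > 0" "b > 0" using assms by auto
  define A B M where "A = a powr p" and "B = b powr q" and "M = a * b"
  have pos': "A > 0" "B > 0" "M > 0" using pos by (auto simp: A_def B_def M_def)
  have M: "A / p + B / q = M" using eq by (simp add: A_def B_def M_def)
  have AM: "ln (A / M) \<le> A / M - 1" and BM: "ln (B / M) \<le> B / M - 1"
    using pos' by (auto intro!: ln_le_minus_one)
  have "ln (A / M) / p + ln (B / M) / q = (ln A / p + ln B / q) - (1 / p + 1 / q) * ln M"
    using pos' by (simp add: ln_div diff_divide_distrib algebra_simps)
  also have "\<dots> = 0"
    using pos assms(1-3) by (simp add: A_def B_def M_def ln_powr ln_mult)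
  also have "\<dots> = (A / p + B / q) / M - (1 / p + 1 / q)"
    using pos' M assms(3) by simp
  also have "\<dots> = (A / M - 1) / p + (B / M - 1) / q"
    by (simp add: diff_divide_distrib add_divide_distrib mult.commute)
  finally have "ln (A / M) / p + ln (B / M) / q = (A / M - 1) / p + (B / M - 1) / q" .
  moreover have "ln (A / M) / p \<le> (A / M - 1) / p" "ln (B / M) / q \<le> (B / M - 1) / q"
    using AM BM assms(1,2) by (auto intro: divide_right_mono)
  ultimately have "ln (A / M) / p = (A / M - 1) / p" "ln (B / M) / q = (B / M - 1) / q"
    by linarith+
  then have "ln (A / M) = A / M - 1" "ln (B / M) = B / M - 1"
    using assms(1,2) by auto
  then have "A / M = 1" "B / M = 1"
    using pos' by (simp_all only: ln_eq_minus_one divide_pos_pos)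
  then show ?thesis using pos' by (simp add: A_def B_def)
qed

text \<open>Young's inequality for \<open>x powr (p - 1)\<close> and \<open>y\<close>, with
  \<open>q\<close> conjugate to \<open>p\<close>, gives the tangent bound, including the case
  \<open>x = 0\<close>.\<close>

lemma powr_above_tangent:
  fixes x y p :: real
  assumes "p > 1" "x \<ge> 0" "y \<ge> 0"
  shows "x powr p + p * x powr (p - 1) * (y - x) \<le> y powr p"
proof -
  define q where "q = p / (p - 1)"
  have q: "q > 1" "1 / q + 1 / p = 1" using assms by (auto simp: q_def field_simps)
  have pow: "(x powr (p - 1)) powr q = x powr p"
    using assms by (simp add: powr_powr q_def)
  have x: "x powr (p - 1) * x = x powr p"
    using assms powr_mult_base[of x "p - 1"] by (simp add: mult.commute)
  have "x powr (p - 1) * y \<le> x powr p / q + y powr p / p"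
    using Youngs_inequality[of q p "x powr (p - 1)" y] assms q pow by simp
  then have "p * (x powr (p - 1) * y) \<le> p * (x powr p / q + y powr p / p)"
    using assms by (intro mult_left_mono) auto
  also have "\<dots> = (p - 1) * x powr p + y powr p"
    using assms by (simp add: q_def field_simps)
  finally show ?thesis using x by (simp add: algebra_simps)
qed

section \<open>The optimality conditions\<close>

text \<open>A point cannot coincide with both \<open>v 1\<close> and \<open>v 2\<close>. This keeps
  the denominators in the conditions nonzero.\<close>

lemma sum_powr_dist_pos:
  fixes v :: "nat \<Rightarrow> 'a::real_normed_vector"
  assumes "n \<ge> 2" "inj_on v {1..n}"
  shows "0 < (\<Sum>i=1..n. norm (u - v i) powr p)"
proof -
  have "v 1 \<noteq> v 2" using assms by (auto dest: inj_onD)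
  then obtain i where "i \<in> {1, 2}" "u \<noteq> v i" by auto
  then show ?thesis using assms(1) by (intro sum_pos2[of _ i]) auto
qed

lemma pdist_pos:
  fixes v :: "nat \<Rightarrow> 'a::real_normed_vector"
  assumes "n \<ge> 2" "inj_on v {1..n}"
  shows "0 < pdist n p v u"
  using sum_powr_dist_pos[OF assms, of u p] by (simp add: pdist_def)

lemma pdist_powr: "p \<noteq> 0 \<Longrightarrow> pdist n p v u powr p = (\<Sum>i=1..n. norm (u - v i) powr p)"
  by (simp add: pdist_def powr_powr sum_nonneg)

lemma pdist_le_iff:
  assumes "p > 0"
  shows "pdist n p v u \<le> pdist n p v w \<longleftrightarrow>
    (\<Sum>i=1..n. norm (u - v i) powr p) \<le> (\<Sum>i=1..n. norm (w - v i) powr p)"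
proof
  have nonneg: "0 \<le> pdist n p v z" for z by (simp add: pdist_def)
  show "(\<Sum>i=1..n. norm (u - v i) powr p) \<le> (\<Sum>i=1..n. norm (w - v i) powr p)"
    if "pdist n p v u \<le> pdist n p v w"
    using powr_mono2[OF _ nonneg that, of p] assms by (simp add: pdist_powr)
qed (use assms in \<open>auto simp: pdist_def intro!: powr_mono2 sum_nonneg\<close>)

text \<open>Each pairing at \<open>w\<close> is at most \<open>norm (x i) * norm (w - v i)\<close>,
  hence at most a Young bound \<open>Y i\<close>, and the \<open>Y i\<close> sum to the objective at
  \<open>w\<close>. Comparing sums gives minimality; equal sums force both inequalities to be
  equalities for every \<open>i\<close>.\<close>

lemma optimality_conditions_dual:
  fixes v :: "nat \<Rightarrow> 'a::real_normed_vector" and x :: "nat \<Rightarrow> 'a \<Rightarrow>\<^sub>L real"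
  assumes n: "n \<ge> 2" and inj: "inj_on v {1..n}"
    and pq: "p > 1" "q > 1" "1 / p + 1 / q = 1"
    and opt: "optimality_conditions n p q v x u"
  shows "pdist n p v u \<le> pdist n p v w"
    and "pdist n p v w = pdist n p v u \<Longrightarrow> i \<in> {1..n} \<Longrightarrow> w \<in> C_set n p q v x i"
proof -
  define T where "T z = pdist n p v z" for z
  \<comment> \<open>Scaling by the objective makes the \<open>p\<close>-th powers sum to 1, matching
    the \<open>q\<close>-th powers of the dual norms.\<close>
  define b where "b z i = norm (z - v i) / T z" for z i
  have sum0: "(\<Sum>i=1..n. x i) = 0" and sum1: "(\<Sum>i=1..n. norm (x i) powr q) = 1"
    and align: "\<And>i. i \<in> {1..n} \<Longrightarrow> blinfun_apply (x i) (u - v i) = norm (x i) * norm (u - v i)"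
    and norm_powr: "\<And>i. i \<in> {1..n} \<Longrightarrow>
      norm (x i) powr q = norm (u - v i) powr p / (\<Sum>j=1..n. norm (u - v j) powr p)"
    using opt by (auto simp: optimality_conditions_def)
  have T: "T z > 0" for z unfolding T_def by (rule pdist_pos[OF n inj])
  have b: "b z i \<ge> 0" for z i using T[of z] by (simp add: b_def)
  have b_powr: "b z i powr p = norm (z - v i) powr p / (\<Sum>j=1..n. norm (z - v j) powr p)" for z i
    using T[of z] pq by (simp add: b_def powr_divide T_def pdist_powr)
  have sum_b: "(\<Sum>i=1..n. b z i powr p) = 1" for z
    using sum_powr_dist_pos[OF n inj, of z p] by (simp add: b_powr flip: sum_divide_distrib)
  have sum_indep: "(\<Sum>i=1..n. blinfun_apply (x i) (z - v i)) = - (\<Sum>i=1..n. blinfun_apply (x i) (v i))"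
    for z
    using arg_cong[OF sum0, of "\<lambda>y. blinfun_apply y z"]
    by (simp add: blinfun.diff_right sum_subtractf blinfun.sum_left)
  \<comment> \<open>At \<open>u\<close> the dual norm is \<open>b u i powr (p - 1)\<close>, so each
    pairing is an exact share of \<open>T u\<close>, and the shares sum to
    \<open>T u\<close>.\<close>
  have "blinfun_apply (x i) (u - v i) = T u * norm (x i) powr q" if i: "i \<in> {1..n}" for i
  proof -
    have eq: "norm (x i) powr q = b u i powr p" using norm_powr[OF i] by (simp add: b_powr)
    have "norm (x i) = (b u i powr p) powr (1 / q)"
      unfolding eq[symmetric] using pq by (simp add: powr_powr)
    also have "\<dots> = b u i powr (p - 1)"
    proof -
      have "p / q = p - 1" using pq by (simp add: field_simps)
      then show ?thesis by (simp add: powr_powr)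
    qed
    finally have "norm (x i) * b u i = b u i powr p"
      using powr_mult_base[OF b, of u i "p - 1"] by (simp add: mult.commute)
    then show ?thesis using T[of u] unfolding align[OF i] eq by (simp add: b_def field_simps)
  qed
  then have Tu: "T u = (\<Sum>i=1..n. blinfun_apply (x i) (w - v i))"
    using sum1 sum_indep[of u] sum_indep[of w] by (simp flip: sum_distrib_left)
  have le1: "blinfun_apply (x i) (w - v i) \<le> norm (x i) * norm (w - v i)" for i
    using norm_blinfun[of "x i" "w - v i"] by simp
  define Y where "Y i = T w * (norm (x i) powr q / q + b w i powr p / p)" for i
  have Rb: "norm (x i) * norm (w - v i) = T w * (norm (x i) * b w i)" for i
    using T[of w] by (simp add: b_def)
  have le2: "norm (x i) * norm (w - v i) \<le> Y i" for i
    unfolding Rb Y_def using Youngs_inequality[of q p "norm (x i)" "b w i"] pq b T[of w]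
    by (intro mult_left_mono) auto
  have le: "blinfun_apply (x i) (w - v i) \<le> Y i" for i
    using le1 le2 order_trans by blast
  have sum_Y: "(\<Sum>i=1..n. Y i) = T w"
  proof -
    have "(\<Sum>i=1..n. Y i) =
        T w * ((\<Sum>i=1..n. norm (x i) powr q) / q + (\<Sum>i=1..n. b w i powr p) / p)"
      unfolding Y_def by (simp add: sum_divide_distrib flip: sum_distrib_left sum.distrib)
    then show ?thesis using pq sum1 sum_b by (simp add: add.commute)
  qed
  have "T u \<le> T w" unfolding Tu sum_Y[symmetric] using le by (intro sum_mono)
  then show "pdist n p v u \<le> pdist n p v w" by (simp add: T_def)
  assume "pdist n p v w = pdist n p v u" and i: "i \<in> {1..n}"
  then have "(\<Sum>i=1..n. blinfun_apply (x i) (w - v i)) = (\<Sum>i=1..n. Y i)"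
    using Tu sum_Y by (simp add: T_def)
  then have "blinfun_apply (x i) (w - v i) = Y i"
    using le i by (rule sum_mono_inv) simp
  then have eq1: "blinfun_apply (x i) (w - v i) = norm (x i) * norm (w - v i)"
    and eq2: "norm (x i) * norm (w - v i) = Y i"
    using le1[of i] le2[of i] by auto
  \<comment> \<open>Cancelling \<open>T w\<close> leaves equality in Young's inequality, which
    yields the power condition of \<open>C_set\<close>.\<close>
  have "norm (x i) * b w i = norm (x i) powr q / q + b w i powr p / p"
    using eq2 T[of w] unfolding Rb Y_def by simp
  then have "norm (x i) powr q = b w i powr p"
    using pq b by (intro Young_equality_imp) auto
  then show "w \<in> C_set n p q v x i"
    using eq1 by (simp add: C_set_def b_powr)
qed

text \<open>
  The tangent inequality for \<open>t powr p\<close>, applied at the convex bounds for the distances from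
  \<open>u + s *\<^sub>R w\<close> and followed by \<open>s \<rightarrow> 0\<close> from the right, avoids differentiating the norm.
\<close>

lemma Sol_imp_weighted_minimizer:
  fixes v :: "nat \<Rightarrow> 'a::real_normed_vector"
  assumes p: "p > 1" and u: "u \<in> Sol n p v"
  shows "(\<Sum>i=1..n. norm (u - v i) powr (p - 1) * norm (u - v i))
    \<le> (\<Sum>i=1..n. norm (u - v i) powr (p - 1) * norm (u - v i + w))"
proof -
  define r R where "r i = norm (u - v i)" and "R i = norm (u - v i + w)" for i
  \<comment> \<open>By convexity \<open>m s i\<close> bounds the distance from
    \<open>u + s *\<^sub>R w\<close> to \<open>v i\<close>, with equality at
    \<open>s = 0\<close>.\<close>
  define m where "m s i = (1 - s) * r i + s * R i" for s i
  have nonneg: "m s i \<ge> 0" if "s \<in> {0<..<1}" for s i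
    using that by (auto simp: m_def r_def R_def)
  have "(\<Sum>i=1..n. m s i powr (p - 1) * (r i - R i)) \<le> 0" if s: "s \<in> {0<..<1}" for s
  proof -
    have "norm (u + s *\<^sub>R w - v i) \<le> m s i" for i
    proof -
      have "u + s *\<^sub>R w - v i = (1 - s) *\<^sub>R (u - v i) + s *\<^sub>R (u - v i + w)"
        by (simp add: algebra_simps)
      also have "norm \<dots> \<le> m s i"
        using s by (intro norm_triangle_le) (simp add: m_def r_def R_def)
      finally show ?thesis .
    qed
    moreover have "(\<Sum>i=1..n. r i powr p) \<le> (\<Sum>i=1..n. norm (u + s *\<^sub>R w - v i) powr p)"
      using u p by (simp add: Sol_def pdist_le_iff r_def)
    ultimately have "(\<Sum>i=1..n. r i powr p) \<le> (\<Sum>i=1..n. m s i powr p)"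
      using p by (elim order_trans) (auto intro!: sum_mono powr_mono2)
    moreover have "(\<Sum>i=1..n. m s i powr p + p * m s i powr (p - 1) * (r i - m s i))
        \<le> (\<Sum>i=1..n. r i powr p)"
      using p nonneg[OF s] by (intro sum_mono powr_above_tangent) (auto simp: r_def)
    \<comment> \<open>Since \<open>r i - m s i = s * (r i - R i)\<close>, the positive factor
      \<open>p * s\<close> comes out and can be cancelled before the limit.\<close>
    moreover have "p * m s i powr (p - 1) * (r i - m s i) =
        p * s * (m s i powr (p - 1) * (r i - R i))" for i
      by (simp add: m_def algebra_simps)
    ultimately have "p * s * (\<Sum>i=1..n. m s i powr (p - 1) * (r i - R i)) \<le> 0"
      by (simp add: sum.distrib sum_distrib_left)
    then show ?thesis using s p by (simp add: mult_le_0_iff)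
  qed
  then have ev: "\<forall>\<^sub>F s in at_right 0. (\<Sum>i=1..n. m s i powr (p - 1) * (r i - R i)) \<le> 0"
    using eventually_at_right_real[of 0 "1::real"] by (auto elim: eventually_mono)
  have "((\<lambda>s. \<Sum>i=1..n. m s i powr (p - 1) * (r i - R i)) \<longlongrightarrow>
      (\<Sum>i=1..n. r i powr (p - 1) * (r i - R i))) (at_right 0)"
  proof (intro tendsto_sum tendsto_mult tendsto_powr' tendsto_const)
    fix i
    have "((\<lambda>s. (1 - s) * r i + s * R i) \<longlongrightarrow> (1 - 0) * r i + 0 * R i) (at_right 0)"
      by (intro tendsto_intros)
    then show "((\<lambda>s. m s i) \<longlongrightarrow> r i) (at_right 0)"
      by (simp add: m_def)
    \<comment> \<open>When \<open>u = v i\<close> the base tends to 0; the limit survives because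
      the exponent is positive and the base nonnegative.\<close>
    show "r i \<noteq> 0 \<or> 0 < p - 1 \<and> (\<forall>\<^sub>F s in at_right 0. 0 \<le> m s i)"
      using eventually_at_right_real[of 0 "1::real"] nonneg p by (auto elim: eventually_mono)
  qed
  then have "(\<Sum>i=1..n. r i powr (p - 1) * (r i - R i)) \<le> 0"
    using ev by (intro tendsto_upperbound) auto
  then show ?thesis
    by (simp add: r_def R_def algebra_simps sum_subtractf)
qed

lemma Sol_imp_optimality_conditions:
  fixes v :: "nat \<Rightarrow> 'a::real_normed_vector"
  assumes n: "n \<ge> 2" and inj: "inj_on v {1..n}"
    and pq: "p > 1" "q > 1" "1 / p + 1 / q = 1"
    and u: "u \<in> Sol n p v"
  obtains x :: "nat \<Rightarrow> 'a \<Rightarrow>\<^sub>L real" where "optimality_conditions n p q v x u"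
proof -
  define S where "S = (\<Sum>i=1..n. norm (u - v i) powr p)"
  have S: "S > 0" unfolding S_def by (rule sum_powr_dist_pos[OF n inj])
  define c where "c i = norm (u - v i) powr (p - 1)" for i
  obtain f :: "nat \<Rightarrow> 'a \<Rightarrow>\<^sub>L real" where sum0: "(\<Sum>i=1..n. f i) = 0"
    and f_le: "\<And>i. i \<in> {1..n} \<Longrightarrow> norm (f i) \<le> c i"
    and f_eq: "\<And>i. i \<in> {1..n} \<Longrightarrow> blinfun_apply (f i) (u - v i) = c i * norm (u - v i)"
    using balanced_norming_functionals[of "{1..n}" c "\<lambda>i. u - v i"]
      Sol_imp_weighted_minimizer[OF pq(1) u] by (auto simp: c_def)
  \<comment> \<open>If \<open>u = v i\<close>, then \<open>c i = 0\<close> and the upper bound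
    settles it; otherwise attainment at the nonzero vector \<open>u - v i\<close> gives the lower
    bound.\<close>
  have norm_f: "norm (f i) = c i" if i: "i \<in> {1..n}" for i
  proof (cases "u = v i")
    case True
    then show ?thesis using f_le[OF i] by (simp add: c_def)
  next
    case False
    have "c i * norm (u - v i) \<le> norm (f i) * norm (u - v i)"
      using norm_blinfun[of "f i" "u - v i"] f_eq[OF i] by simp
    then show ?thesis using f_le[OF i] False by simp
  qed
  \<comment> \<open>Chosen so that \<open>k powr q = 1 / S\<close>; since \<open>c i powr q\<close>
    is the \<open>p\<close>-th power of the distance, this normalizes the dual norms.\<close>
  define k where "k = S powr (- 1 / q)"
  have k: "k > 0" using S by (simp add: k_def)
  define x where "x i = k *\<^sub>R f i" for i
  have norm_x: "norm (x i) powr q = norm (u - v i) powr p / S" if i: "i \<in> {1..n}" for i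
  proof -
    have "(p - 1) * q = p" using pq by (simp add: field_simps)
    then have "c i powr q = norm (u - v i) powr p" by (simp add: c_def powr_powr)
    moreover have "k powr q = 1 / S" using pq S by (simp add: k_def powr_powr powr_minus_divide powr_divide)
    ultimately show ?thesis
      using k by (simp add: x_def norm_f[OF i] powr_mult)
  qed
  have "optimality_conditions n p q v x u"
    unfolding optimality_conditions_def
  proof (intro conjI ballI)
    show "(\<Sum>i=1..n. x i) = 0"
      using sum0 by (simp add: x_def flip: scaleR_sum_right)
    show "(\<Sum>i=1..n. norm (x i) powr q) = 1"
      using S norm_x by (simp add: S_def flip: sum_divide_distrib)
    fix i assume i: "i \<in> {1..n}"
    show "blinfun_apply (x i) (u - v i) = norm (x i) * norm (u - v i)"
      using k by (simp add: x_def blinfun.scaleR_left f_eq[OF i] norm_f[OF i])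
    show "norm (x i) powr q = norm (u - v i) powr p / (\<Sum>j=1..n. norm (u - v j) powr p)"
      using norm_x[OF i] by (simp add: S_def)
  qed
  then show thesis by (rule that)
qed

theorem theorem7p1:
  fixes v :: "nat \<Rightarrow> 'a::real_normed_vector" and n :: nat and p q :: real
  assumes "n \<ge> 2" and "inj_on v {1..n}"
    and "p > 1" and "q > 1" and "1 / p + 1 / q = 1"
  shows "(\<forall>u. u \<in> Sol n p v \<longleftrightarrow>
            (\<exists>x :: nat \<Rightarrow> 'a \<Rightarrow>\<^sub>L real. optimality_conditions n p q v x u)) \<and>
         (\<forall>u (x :: nat \<Rightarrow> 'a \<Rightarrow>\<^sub>L real).
            u \<in> Sol n p v \<and> optimality_conditions n p q v x u \<longrightarrow>
            Sol n p v = (\<Inter>i\<in>{1..n}. C_set n p q v x i))"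
proof (intro conjI allI impI)
  have suff: "u \<in> Sol n p v" if "optimality_conditions n p q v x u" for u x
    using optimality_conditions_dual(1)[OF assms that] by (simp add: Sol_def)
  show "u \<in> Sol n p v \<longleftrightarrow> (\<exists>x :: nat \<Rightarrow> 'a \<Rightarrow>\<^sub>L real. optimality_conditions n p q v x u)" for u
    using suff Sol_imp_optimality_conditions[OF assms] by blast
  fix u and x :: "nat \<Rightarrow> 'a \<Rightarrow>\<^sub>L real"
  assume ux: "u \<in> Sol n p v \<and> optimality_conditions n p q v x u"
  show "Sol n p v = (\<Inter>i\<in>{1..n}. C_set n p q v x i)"
  proof (intro equalityI subsetI)
    fix w assume "w \<in> Sol n p v"
    then have "pdist n p v w = pdist n p v u" using ux by (auto simp: Sol_def intro: antisym)
    then show "w \<in> (\<Inter>i\<in>{1..n}. C_set n p q v x i)"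
      using optimality_conditions_dual(2)[OF assms conjunct2[OF ux]] by blast
  next
    fix w assume "w \<in> (\<Inter>i\<in>{1..n}. C_set n p q v x i)"
    \<comment> \<open>The two sum conditions do not involve the point, so they carry over from
      \<open>u\<close> to \<open>w\<close>.\<close>
    then have "optimality_conditions n p q v x w"
      using ux unfolding optimality_conditions_def C_set_def by blast
    then show "w \<in> Sol n p v" by (rule suff)
  qed
qed

end
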